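(* Let $s\in(0,1)$, $1<p<+\infty$, and let $\Omega$ be an open bounded set in $\mathbb{R}^N$. Then the following conditions are equivalent: (i) for every sequence $\{s_j\}_j\subset(0,1)$ strictly increasing to $s$, it holds $\Gamma\text{-}\lim_{j\to+\infty}\mathcal{E}^{s_j}=\mathcal{E}^{s}$, with respect to $\Gamma$-convergence in $L^p(\Omega)$; (ii) $W^{s^-,p}_0(\Omega)=W^{s,p}_0(\Omega)$.
   Context: For $0<\sigma<1$, $W^{\sigma,p}(\Omega)$ is the space of $u\in L^p(\Omega)$ with $\int_{\Omega\times\Omega}\frac{|u(x)-u(y)|^p}{|x-y|^{N+\sigma p}}\,dx\,dy<\infty$, with its usual norm. $W^{\sigma,p}_0(\Omega)$ is the closure of $C_0^\infty(\Omega)$ (smooth functions compactly supported in $\Omega$) in $W^{\sigma,p}(\Omega)$. No regularity of $\partial\Omega$ is assumed. Set $$W^{s^-,p}_0(\Omega)=W^{s,p}(\Omega)\cap\Big(\bigcap_{0<k<s}W^{k,p}_0(\Omega)\Big).$$ Define $\mathcal{E}^\sigma:L^p(\Omega)\to[0,+\infty]$ by $$\mathcal{E}^\sigma(u)=\int_{\Omega\times\Omega}\frac{|u(x)-u(y)|^p}{|x-y|^{N+\sigma p}}\,dx\,dy\ \text{ if }u\in W^{\sigma,p}_0(\Omega),\quad+\infty\text{ otherwise}.$$ $\Gamma$-convergence: for a metric space $X$, functionals $E_n:X\to\mathbb{R}\cup\{\infty\}$ $\Gamma$-converge to $E$ if (a) for every $u\in X$ and every $u_n\to u$ in $X$, $E(u)\le\liminf_n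 E_n(u_n)$; and (b) for every $u\in X$ there is a sequence $u_n\to u$ in $X$ with $E(u)\ge\limsup_n E_n(u_n)$. Here $X=L^p(\Omega)$ with its norm metric. *)

theory Defs
  imports "HOL-Analysis.Analysis"
begin

text \<open>
  Elements of \<open>L\<^sup>p(\<Omega>)\<close> are represented by measurable functions on the ambient space; values
  outside \<open>\<Omega>\<close> are irrelevant. Every notion below is invariant under changing a function on a
  null set of \<open>\<Omega>\<close>, so no quotient is formed and the \<open>L\<^sup>p\<close>-distance is a pseudometric on
  representatives.
\<close>

definition Lp :: "real \<Rightarrow> 'a::euclidean_space set \<Rightarrow> ('a \<Rightarrow> real) set" where
  "Lp p \<Omega> = {u \<in> borel_measurable (lebesgue_on \<Omega>).
     (\<integral>\<^sup>+ x. ennreal (\<bar>u x\<bar> powr p) \<partial>lebesgue_on \<Omega>) < \<infinity>}"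

definition Lp_dist :: "real \<Rightarrow> 'a::euclidean_space set \<Rightarrow> ('a \<Rightarrow> real) \<Rightarrow> ('a \<Rightarrow> real) \<Rightarrow> real" where
  "Lp_dist p \<Omega> u v =
     enn2real (\<integral>\<^sup>+ x. ennreal (\<bar>u x - v x\<bar> powr p) \<partial>lebesgue_on \<Omega>) powr (1 / p)"

text \<open>The diagonal contributes nothing: there the integrand is \<open>0 / 0 = 0\<close>.\<close>

definition gagliardo :: "real \<Rightarrow> real \<Rightarrow> 'a::euclidean_space set \<Rightarrow> ('a \<Rightarrow> real) \<Rightarrow> ennreal" where
  "gagliardo \<sigma> p \<Omega> u =
     (\<integral>\<^sup>+ (x, y). ennreal (\<bar>u x - u y\<bar> powr p / norm (x - y) powr (real DIM('a) + \<sigma> * p))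
        \<partial>(lebesgue_on \<Omega> \<Otimes>\<^sub>M lebesgue_on \<Omega>))"

definition W :: "real \<Rightarrow> real \<Rightarrow> 'a::euclidean_space set \<Rightarrow> ('a \<Rightarrow> real) set" where
  "W \<sigma> p \<Omega> = {u \<in> Lp p \<Omega>. gagliardo \<sigma> p \<Omega> u < \<infinity>}"

text \<open>Meaningful only on \<open>W \<sigma> p \<Omega>\<close>, since \<open>enn2real \<infinity> = 0\<close>.\<close>

definition W_norm :: "real \<Rightarrow> real \<Rightarrow> 'a::euclidean_space set \<Rightarrow> ('a \<Rightarrow> real) \<Rightarrow> real" where
  "W_norm \<sigma> p \<Omega> u =
     enn2real ((\<integral>\<^sup>+ x. ennreal (\<bar>u x\<bar> powr p) \<partial>lebesgue_on \<Omega>) + gagliardo \<sigma> p \<Omega> u) powr (1 / p)"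

text \<open>
  \<open>C\<^sup>k\<close> on the whole space, by recursion on partial derivatives: a function with \<open>C\<^sup>k\<close> partial
  derivatives that is differentiable is \<open>C\<^sup>k\<^sup>+\<^sup>1\<close>, and conversely.
\<close>

primrec C_k :: "nat \<Rightarrow> ('a::euclidean_space \<Rightarrow> real) \<Rightarrow> bool" where
  "C_k 0 f \<longleftrightarrow> continuous_on UNIV f"
| "C_k (Suc k) f \<longleftrightarrow> (\<forall>x. f differentiable (at x)) \<and>
     (\<forall>b\<in>Basis. C_k k (\<lambda>x. frechet_derivative f (at x) b))"

text \<open>A function compactly supported in the open set \<open>\<Omega>\<close> is identified with its extension by zero.\<close>

definition test_functions :: "'a::euclidean_space set \<Rightarrow> ('a \<Rightarrow> real) set" where
  "test_functions \<Omega> = {\<phi>. (\<forall>k. C_k k \<phi>) \<and>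
     compact (closure {x. \<phi> x \<noteq> 0}) \<and> closure {x. \<phi> x \<noteq> 0} \<subseteq> \<Omega>}"

text \<open>
  The closure of the test functions in \<open>W \<sigma> p \<Omega>\<close>. The difference is required to lie in \<open>W \<sigma> p \<Omega>\<close>
  so that \<open>W_norm\<close> is only used where it is meaningful.
\<close>

definition W0 :: "real \<Rightarrow> real \<Rightarrow> 'a::euclidean_space set \<Rightarrow> ('a \<Rightarrow> real) set" where
  "W0 \<sigma> p \<Omega> = {u \<in> W \<sigma> p \<Omega>. \<forall>\<epsilon>>0. \<exists>\<phi>\<in>test_functions \<Omega>.
     (\<lambda>x. u x - \<phi> x) \<in> W \<sigma> p \<Omega> \<and> W_norm \<sigma> p \<Omega> (\<lambda>x. u x - \<phi> x) < \<epsilon>}"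

definition W0_minus :: "real \<Rightarrow> real \<Rightarrow> 'a::euclidean_space set \<Rightarrow> ('a \<Rightarrow> real) set" where
  "W0_minus s p \<Omega> = W s p \<Omega> \<inter> (\<Inter>k\<in>{0<..<s}. W0 k p \<Omega>)"

definition energy :: "real \<Rightarrow> real \<Rightarrow> 'a::euclidean_space set \<Rightarrow> ('a \<Rightarrow> real) \<Rightarrow> ennreal" where
  "energy \<sigma> p \<Omega> u = (if u \<in> W0 \<sigma> p \<Omega> then gagliardo \<sigma> p \<Omega> u else \<infinity>)"

text \<open>
  \<open>\<Gamma>\<close>-convergence on a set \<open>X\<close> with (pseudo)metric \<open>d\<close>; the codomain is any complete linear
  order, such as \<open>ennreal\<close> for nonnegative functionals.
\<close>

definition Gamma_converges ::
  "'x set \<Rightarrow> ('x \<Rightarrow> 'x \<Rightarrow> real) \<Rightarrow> (nat \<Rightarrow> 'x \<Rightarrow> 'b::complete_linorder) \<Rightarrow> ('x \<Rightarrow> 'b) \<Rightarrow> bool" where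
  "Gamma_converges X d En E \<longleftrightarrow>
     (\<forall>u\<in>X. \<forall>v. (\<forall>n. v n \<in> X) \<and> (\<lambda>n. d (v n) u) \<longlonglongrightarrow> 0 \<longrightarrow>
        E u \<le> liminf (\<lambda>n. En n (v n))) \<and>
     (\<forall>u\<in>X. \<exists>v. (\<forall>n. v n \<in> X) \<and> (\<lambda>n. d (v n) u) \<longlonglongrightarrow> 0 \<and>
        limsup (\<lambda>n. En n (v n)) \<le> E u)"

end

theory Submission
  imports Defs
begin

text \<open>
  On a bounded set, \<open>D\<^sup>\<sigma>\<^sup>p\<close> times the Gagliardo energy of order \<open>\<sigma>\<close>, with \<open>D\<close> the diameter, is
  nondecreasing in \<open>\<sigma>\<close>, so the spaces \<open>W\<^sub>0\<close> are nested and constant sequences are recovery sequences.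
  Splitting the double integral at distance \<open>\<delta>\<close> shows that a sequence which converges in \<open>L\<^sup>p\<close>
  and is bounded in \<open>W\<close> of order \<open>\<tau>\<close> converges strongly in every order \<open>\<sigma> < \<tau>\<close>; hence the \<open>L\<^sup>p\<close>-limit
  of a sequence with bounded energies of orders increasing to \<open>s\<close> lies in \<open>W\<^sub>0\<close> of every order below \<open>s\<close>,
  without any appeal to weak compactness, and Fatou's lemma bounds its energy of order \<open>s\<close>. This
  gives the lower bound when \<open>W0_minus\<close> is \<open>W0\<close>; conversely the lower bound along a constant
  sequence \<open>u\<close> in \<open>W0_minus\<close> forces its limit energy to be finite.
\<close>

section \<open>Powers of the norms: measurability and quasi-triangle inequalities\<close>

text \<open>The p-th power of the norm, kept in \<open>ennreal\<close> so that inequalities need no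
  finiteness side conditions and infinite values stay infinite.\<close>

definition Lp_mass :: "real \<Rightarrow> 'a::euclidean_space set \<Rightarrow> ('a \<Rightarrow> real) \<Rightarrow> ennreal" where
  "Lp_mass p \<Omega> u = (\<integral>\<^sup>+ x. ennreal (\<bar>u x\<bar> powr p) \<partial>lebesgue_on \<Omega>)"

text \<open>Real-valued and a function of the pair, so that pointwise estimates are plain real
  inequalities and measurability on the product is proved once.\<close>

definition gagliardo_integrand :: "real \<Rightarrow> real \<Rightarrow> ('a::euclidean_space \<Rightarrow> real) \<Rightarrow> 'a \<times> 'a \<Rightarrow> real" where
  "gagliardo_integrand \<sigma> p u =
     (\<lambda>(x, y). \<bar>u x - u y\<bar> powr p / norm (x - y) powr (real DIM('a) + \<sigma> * p))"

lemma gagliardo_eq: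
  "gagliardo \<sigma> p \<Omega> u =
     (\<integral>\<^sup>+ z. ennreal (gagliardo_integrand \<sigma> p u z) \<partial>(lebesgue_on \<Omega> \<Otimes>\<^sub>M lebesgue_on \<Omega>))"
  unfolding gagliardo_def gagliardo_integrand_def by (intro nn_integral_cong) auto

lemma gagliardo_integrand_nonneg: "0 \<le> gagliardo_integrand \<sigma> p u z"
  by (auto simp: gagliardo_integrand_def split_beta)

lemma id_measurable_lebesgue_on: "(\<lambda>x. x) \<in> borel_measurable (lebesgue_on \<Omega>)"
  by (intro measurable_restrict_space1 measurable_completion) simp

lemma gagliardo_integrand_measurable:
  assumes [measurable]: "u \<in> borel_measurable (lebesgue_on \<Omega>)"
  shows "gagliardo_integrand \<sigma> p u \<in> borel_measurable (lebesgue_on \<Omega> \<Otimes>\<^sub>M lebesgue_on \<Omega>)"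
proof -
  note id_measurable_lebesgue_on[of \<Omega>, measurable]
  show ?thesis
    unfolding gagliardo_integrand_def by measurable
qed

text \<open>Serves Tonelli in the splitting estimate and the passage from null sets to null sets of
  pairs before Fatou's lemma.\<close>

lemma pair_sigma_finite_lebesgue_on:
  assumes "\<Omega> \<in> lmeasurable"
  shows "pair_sigma_finite (lebesgue_on \<Omega>) (lebesgue_on \<Omega>)"
  using finite_measure.axioms(1)[OF finite_measure_lebesgue_on[OF assms]]
  by (simp add: pair_sigma_finite_def)

text \<open>Bounding the sum by twice the larger term avoids convexity. The constant is not sharp,
  but later only its finiteness matters.\<close>

lemma abs_add_powr_le:
  fixes a b p :: real
  assumes "0 \<le> p"
  shows "\<bar>a + b\<bar> powr p \<le> 2 powr p * (\<bar>a\<bar> powr p + \<bar>b\<bar> powr p)"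
proof -
  have "\<bar>a + b\<bar> powr p \<le> (2 * max \<bar>a\<bar> \<bar>b\<bar>) powr p"
    using assms by (intro powr_mono2) auto
  also have "\<dots> = 2 powr p * max \<bar>a\<bar> \<bar>b\<bar> powr p"
    by (simp add: powr_mult)
  also have "\<dots> \<le> 2 powr p * (\<bar>a\<bar> powr p + \<bar>b\<bar> powr p)"
    by (intro mult_left_mono) (auto simp: max_def)
  finally show ?thesis .
qed

lemma Lp_mass_add_le:
  assumes [measurable]: "u \<in> borel_measurable (lebesgue_on \<Omega>)" "v \<in> borel_measurable (lebesgue_on \<Omega>)"
    and "0 \<le> p"
  shows "Lp_mass p \<Omega> (\<lambda>x. u x + v x) \<le> ennreal (2 powr p) * (Lp_mass p \<Omega> u + Lp_mass p \<Omega> v)"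
proof -
  have "Lp_mass p \<Omega> (\<lambda>x. u x + v x)
    \<le> (\<integral>\<^sup>+ x. ennreal (2 powr p) * (ennreal (\<bar>u x\<bar> powr p) + ennreal (\<bar>v x\<bar> powr p)) \<partial>lebesgue_on \<Omega>)"
    unfolding Lp_mass_def using abs_add_powr_le[OF \<open>0 \<le> p\<close>]
    by (intro nn_integral_mono) (simp add: ennreal_plus[symmetric] ennreal_mult[symmetric] ennreal_leI del: ennreal_plus)
  also have "\<dots> = ennreal (2 powr p) * (Lp_mass p \<Omega> u + Lp_mass p \<Omega> v)"
    unfolding Lp_mass_def by (simp add: nn_integral_cmult nn_integral_add)
  finally show ?thesis .
qed

lemma gagliardo_add_le:
  assumes [measurable]: "u \<in> borel_measurable (lebesgue_on \<Omega>)" "v \<in> borel_measurable (lebesgue_on \<Omega>)"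
    and "0 \<le> p"
  shows "gagliardo \<sigma> p \<Omega> (\<lambda>x. u x + v x)
    \<le> ennreal (2 powr p) * (gagliardo \<sigma> p \<Omega> u + gagliardo \<sigma> p \<Omega> v)"
proof -
  note gagliardo_integrand_measurable[measurable]
  have "gagliardo_integrand \<sigma> p (\<lambda>x. u x + v x) z
      \<le> 2 powr p * (gagliardo_integrand \<sigma> p u z + gagliardo_integrand \<sigma> p v z)" for z
  proof -
    obtain x y where z: "z = (x, y)" by fastforce
    show ?thesis
      using divide_right_mono[OF abs_add_powr_le[OF \<open>0 \<le> p\<close>, of "u x - u y" "v x - v y"],
        of "norm (x - y) powr (real DIM('a) + \<sigma> * p)"]
      by (simp add: z gagliardo_integrand_def algebra_simps add_divide_distrib)
  qed
  then have "gagliardo \<sigma> p \<Omega> (\<lambda>x. u x + v x)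
    \<le> (\<integral>\<^sup>+ z. ennreal (2 powr p) * (ennreal (gagliardo_integrand \<sigma> p u z)
        + ennreal (gagliardo_integrand \<sigma> p v z)) \<partial>(lebesgue_on \<Omega> \<Otimes>\<^sub>M lebesgue_on \<Omega>))"
    unfolding gagliardo_eq
    by (intro nn_integral_mono)
      (simp add: ennreal_plus[symmetric] ennreal_mult[symmetric] ennreal_leI
        gagliardo_integrand_nonneg del: ennreal_plus)
  also have "\<dots> = ennreal (2 powr p) * (gagliardo \<sigma> p \<Omega> u + gagliardo \<sigma> p \<Omega> v)"
    unfolding gagliardo_eq by (simp add: nn_integral_cmult nn_integral_add)
  finally show ?thesis .
qed

lemma gagliardo_uminus: "gagliardo \<sigma> p \<Omega> (\<lambda>x. - u x) = gagliardo \<sigma> p \<Omega> u"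
proof -
  have "\<bar>- a - - b\<bar> = \<bar>a - b\<bar>" for a b :: real by linarith
  then show ?thesis by (simp add: gagliardo_def)
qed

lemma gagliardo_diff_le:
  assumes "u \<in> borel_measurable (lebesgue_on \<Omega>)" "v \<in> borel_measurable (lebesgue_on \<Omega>)" "0 \<le> p"
  shows "gagliardo \<sigma> p \<Omega> (\<lambda>x. u x - v x)
    \<le> ennreal (2 powr p) * (gagliardo \<sigma> p \<Omega> u + gagliardo \<sigma> p \<Omega> v)"
  using gagliardo_add_le[of u \<Omega> "\<lambda>x. - v x" p \<sigma>] assms by (simp add: gagliardo_uminus)

lemma Lp_mass_diff_le:
  assumes "u \<in> borel_measurable (lebesgue_on \<Omega>)" "v \<in> borel_measurable (lebesgue_on \<Omega>)" "0 \<le> p"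
  shows "Lp_mass p \<Omega> (\<lambda>x. u x - v x) \<le> ennreal (2 powr p) * (Lp_mass p \<Omega> u + Lp_mass p \<Omega> v)"
  using Lp_mass_add_le[of u \<Omega> "\<lambda>x. - v x" p] assms by (simp add: Lp_mass_def)

section \<open>Comparison of energies of different orders\<close>

text \<open>At distance \<open>d\<close> the integrand of order \<open>\<sigma>\<close> is
  \<open>d powr ((\<tau> - \<sigma>) * p)\<close> times the one of order \<open>\<tau>\<close>; this
  factor has a nonnegative exponent and \<open>d\<close> is at most \<open>D\<close>.\<close>

lemma gagliardo_mono_exponent:
  assumes [measurable]: "u \<in> borel_measurable (lebesgue_on \<Omega>)"
    and D: "\<And>x y. x \<in> \<Omega> \<Longrightarrow> y \<in> \<Omega> \<Longrightarrow> norm (x - y) \<le> D"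
    and "\<sigma> \<le> \<tau>" "0 \<le> p"
  shows "gagliardo \<sigma> p \<Omega> u \<le> ennreal (D powr ((\<tau> - \<sigma>) * p)) * gagliardo \<tau> p \<Omega> u"
proof -
  note gagliardo_integrand_measurable[measurable]
  have le: "gagliardo_integrand \<sigma> p u (x, y)
    \<le> D powr ((\<tau> - \<sigma>) * p) * gagliardo_integrand \<tau> p u (x, y)" if "x \<in> \<Omega>" "y \<in> \<Omega>" for x y
  proof (cases "x = y")
    case True
    then show ?thesis by (simp add: gagliardo_integrand_def)
  next
    case False
    define d where "d = norm (x - y)"
    have d: "0 < d" "d \<le> D" using False D that by (auto simp: d_def)
    define A where "A = \<bar>u x - u y\<bar> powr p"
    define E where "E = d powr (real DIM('a) + \<tau> * p)"
    have E: "E > 0" using d by (simp add: E_def)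
    have "A / d powr (real DIM('a) + \<sigma> * p) = d powr ((\<tau> - \<sigma>) * p) * (A / E)"
      using d by (simp add: E_def algebra_simps powr_diff powr_add)
    also have "\<dots> \<le> D powr ((\<tau> - \<sigma>) * p) * (A / E)"
      using d assms E by (intro mult_right_mono powr_mono2) (auto simp: A_def)
    finally show ?thesis by (simp add: gagliardo_integrand_def A_def E_def d_def)
  qed
  have "gagliardo \<sigma> p \<Omega> u \<le> (\<integral>\<^sup>+ z. ennreal (D powr ((\<tau> - \<sigma>) * p)) *
      ennreal (gagliardo_integrand \<tau> p u z) \<partial>(lebesgue_on \<Omega> \<Otimes>\<^sub>M lebesgue_on \<Omega>))"
    unfolding gagliardo_eq
    by (intro nn_integral_mono)
      (auto simp: space_pair_measure ennreal_mult[symmetric] gagliardo_integrand_nonneg intro!: ennreal_leI le)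
  also have "\<dots> = ennreal (D powr ((\<tau> - \<sigma>) * p)) * gagliardo \<tau> p \<Omega> u"
    unfolding gagliardo_eq by (simp add: nn_integral_cmult)
  finally show ?thesis .
qed

text \<open>Splitting at distance \<open>\<delta>\<close>: close pairs are controlled by the larger exponent, far pairs by
  the \<open>L\<^sup>p\<close>-norm.\<close>

lemma gagliardo_interpolation:
  assumes [measurable]: "u \<in> borel_measurable (lebesgue_on \<Omega>)"
    and \<Omega>: "\<Omega> \<in> lmeasurable" and "\<sigma> \<le> \<tau>" "0 \<le> p" "0 \<le> \<sigma>" "0 < \<delta>"
  shows "gagliardo \<sigma> p \<Omega> u \<le> ennreal (\<delta> powr ((\<tau> - \<sigma>) * p)) * gagliardo \<tau> p \<Omega> u
    + ennreal (2 powr p / \<delta> powr (real DIM('a) + \<sigma> * p)) *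
      (2 * emeasure lebesgue \<Omega> * Lp_mass p \<Omega> (u :: 'a::euclidean_space \<Rightarrow> real))"
proof -
  note gagliardo_integrand_measurable[measurable]
  interpret pair_sigma_finite "lebesgue_on \<Omega>" "lebesgue_on \<Omega>"
    by (rule pair_sigma_finite_lebesgue_on[OF \<Omega>])
  let ?P = "lebesgue_on \<Omega> \<Otimes>\<^sub>M lebesgue_on \<Omega>"
  \<comment> \<open>\<open>a\<close> is the factor gained on pairs at distance at most
    \<open>\<delta>\<close>; \<open>b\<close> combines the kernel at distance
    \<open>\<delta>\<close>, its largest value on the far pairs, with the constant of
    \<open>abs_add_powr_le\<close>.\<close>
  define a where "a = \<delta> powr ((\<tau> - \<sigma>) * p)"
  define b where "b = 2 powr p / \<delta> powr (real DIM('a) + \<sigma> * p)"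
  have ab: "a \<ge> 0" "b \<ge> 0" by (auto simp: a_def b_def)
  have le: "gagliardo_integrand \<sigma> p u (x, y)
    \<le> a * gagliardo_integrand \<tau> p u (x, y) + b * (\<bar>u x\<bar> powr p + \<bar>u y\<bar> powr p)" for x y
  proof (cases "x = y")
    case True
    then show ?thesis using ab by (simp add: gagliardo_integrand_def)
  next
    case False
    define d where "d = norm (x - y)"
    have d: "0 < d" using False by (auto simp: d_def)
    define A where "A = \<bar>u x - u y\<bar> powr p"
    define E where "E = d powr (real DIM('a) + \<tau> * p)"
    have E: "E > 0" using d by (simp add: E_def)
    have A: "A \<le> 2 powr p * (\<bar>u x\<bar> powr p + \<bar>u y\<bar> powr p)" "A \<ge> 0"
      using abs_add_powr_le[OF \<open>0 \<le> p\<close>, of "u x" "- u y"] by (auto simp: A_def)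
    have "A / d powr (real DIM('a) + \<sigma> * p) \<le> a * (A / E) + b * (\<bar>u x\<bar> powr p + \<bar>u y\<bar> powr p)"
    proof (cases "d \<le> \<delta>")
      case True
      have "A / d powr (real DIM('a) + \<sigma> * p) = d powr ((\<tau> - \<sigma>) * p) * (A / E)"
        using d by (simp add: E_def algebra_simps powr_diff powr_add)
      also have "\<dots> \<le> a * (A / E)"
        unfolding a_def using d True assms E A by (intro mult_right_mono powr_mono2) auto
      also have "\<dots> \<le> a * (A / E) + b * (\<bar>u x\<bar> powr p + \<bar>u y\<bar> powr p)"
        using ab by simp
      finally show ?thesis .
    next
      case False
      have "A / d powr (real DIM('a) + \<sigma> * p) \<le> A / \<delta> powr (real DIM('a) + \<sigma> * p)"
        using False assms d A by (intro divide_left_mono powr_mono2) auto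
      also have "\<dots> \<le> (2 powr p * (\<bar>u x\<bar> powr p + \<bar>u y\<bar> powr p)) / \<delta> powr (real DIM('a) + \<sigma> * p)"
        using A by (intro divide_right_mono) auto
      also have "\<dots> = b * (\<bar>u x\<bar> powr p + \<bar>u y\<bar> powr p)"
        by (simp add: b_def)
      also have "\<dots> \<le> a * (A / E) + b * (\<bar>u x\<bar> powr p + \<bar>u y\<bar> powr p)"
        using ab A E by simp
      finally show ?thesis .
    qed
    then show ?thesis by (simp add: gagliardo_integrand_def A_def E_def d_def)
  qed
  \<comment> \<open>In each far term one variable is free and integrates to the measure of
    \<open>\<Omega>\<close>; the two symmetric terms produce the factor 2.\<close>
  have m: "Lp_mass p \<Omega> u * emeasure lebesgue \<Omega> = (\<integral>\<^sup>+ z. ennreal (\<bar>u (fst z)\<bar> powr p) \<partial>?P)"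
    by (subst M1.nn_integral_fst[symmetric])
      (auto simp: Lp_mass_def nn_integral_multc emeasure_restrict_space fmeasurableD[OF \<Omega>])
  have m': "emeasure lebesgue \<Omega> * Lp_mass p \<Omega> u = (\<integral>\<^sup>+ z. ennreal (\<bar>u (snd z)\<bar> powr p) \<partial>?P)"
    by (subst M1.nn_integral_fst[symmetric])
      (auto simp: Lp_mass_def nn_integral_cmult emeasure_restrict_space fmeasurableD[OF \<Omega>] mult.commute)
  have "gagliardo \<sigma> p \<Omega> u \<le> (\<integral>\<^sup>+ z. ennreal a * ennreal (gagliardo_integrand \<tau> p u z)
     + ennreal b * (ennreal (\<bar>u (fst z)\<bar> powr p) + ennreal (\<bar>u (snd z)\<bar> powr p)) \<partial>?P)"
    unfolding gagliardo_eq
    by (intro nn_integral_mono)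
      (auto simp: space_pair_measure ennreal_mult[symmetric] ennreal_plus[symmetric] ab
        gagliardo_integrand_nonneg simp del: ennreal_plus intro!: ennreal_leI le)
  also have "\<dots> = ennreal a * gagliardo \<tau> p \<Omega> u
     + ennreal b * (Lp_mass p \<Omega> u * emeasure lebesgue \<Omega> + emeasure lebesgue \<Omega> * Lp_mass p \<Omega> u)"
    unfolding gagliardo_eq m m' by (simp add: nn_integral_cmult nn_integral_add)
  also have "Lp_mass p \<Omega> u * emeasure lebesgue \<Omega> + emeasure lebesgue \<Omega> * Lp_mass p \<Omega> u
     = 2 * emeasure lebesgue \<Omega> * Lp_mass p \<Omega> u"
    by (simp add: mult_2 distrib_right distrib_left mult.commute)
  finally show ?thesis unfolding a_def b_def .
qed

section \<open>Membership in \<open>W\<close> and \<open>W0\<close> expressed through p-th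
  powers\<close>

lemma Lp_iff: "u \<in> Lp p \<Omega> \<longleftrightarrow> u \<in> borel_measurable (lebesgue_on \<Omega>) \<and> Lp_mass p \<Omega> u < \<infinity>"
  by (simp add: Lp_def Lp_mass_def)

lemma W_iff: "u \<in> W \<sigma> p \<Omega> \<longleftrightarrow> u \<in> borel_measurable (lebesgue_on \<Omega>) \<and>
    Lp_mass p \<Omega> u + gagliardo \<sigma> p \<Omega> u < \<infinity>"
  by (auto simp: W_def Lp_iff ennreal_add_less_top)

lemma test_function_measurable:
  assumes "\<phi> \<in> test_functions \<Omega>"
  shows "\<phi> \<in> borel_measurable (lebesgue_on A)"
proof -
  have "C_k 0 \<phi>" using assms unfolding test_functions_def by blast
  then have "\<phi> \<in> borel_measurable borel"
    by (simp add: borel_measurable_continuous_onI)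
  then show ?thesis
    by (intro measurable_restrict_space1 measurable_completion) simp
qed

text \<open>Membership in \<open>W\<close> makes the sum finite, which excludes the case where
  \<open>enn2real\<close> would turn infinity into a small norm.\<close>

lemma W_norm_less_iff:
  assumes "u \<in> W \<sigma> p \<Omega>" "0 < p" "0 < \<epsilon>"
  shows "W_norm \<sigma> p \<Omega> u < \<epsilon> \<longleftrightarrow> Lp_mass p \<Omega> u + gagliardo \<sigma> p \<Omega> u < ennreal (\<epsilon> powr p)"
proof -
  define m where "m = Lp_mass p \<Omega> u + gagliardo \<sigma> p \<Omega> u"
  have m: "m < \<infinity>" using assms by (simp add: W_iff m_def)
  define r where "r = enn2real m"
  have r: "m = ennreal r" "0 \<le> r" using m by (auto simp: r_def)
  have "W_norm \<sigma> p \<Omega> u = r powr (1 / p)"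
    by (simp add: W_norm_def r_def m_def Lp_mass_def)
  moreover have "r powr (1 / p) < \<epsilon> \<longleftrightarrow> r < \<epsilon> powr p"
    using powr_less_mono2[of p "r powr (1 / p)" \<epsilon>] powr_less_mono2[of "1 / p" r "\<epsilon> powr p"] assms r
    by (auto simp: powr_powr)
  ultimately show ?thesis
    using r by (simp add: m_def[symmetric] ennreal_less_iff)
qed

text \<open>The requirement that the difference lie in \<open>W\<close> is absorbed: a strict bound
  by a real number in \<open>ennreal\<close> already forces finiteness. The exponent on the
  tolerance disappears because \<open>\<epsilon> powr p\<close> takes every positive value.\<close>

lemma W0_iff:
  assumes p: "0 < p"
  shows "u \<in> W0 \<sigma> p \<Omega> \<longleftrightarrow> u \<in> W \<sigma> p \<Omega> \<and> (\<forall>\<epsilon>>0. \<exists>\<phi>\<in>test_functions \<Omega>.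
     Lp_mass p \<Omega> (\<lambda>x. u x - \<phi> x) + gagliardo \<sigma> p \<Omega> (\<lambda>x. u x - \<phi> x) < ennreal \<epsilon>)"
    (is "_ \<longleftrightarrow> _ \<and> (\<forall>\<epsilon>>0. \<exists>\<phi>\<in>_. ?P \<phi> < _)")
proof (cases "u \<in> W \<sigma> p \<Omega>")
  case True
  then have [measurable]: "u \<in> borel_measurable (lebesgue_on \<Omega>)" by (simp add: W_iff)
  have iff: "(\<lambda>x. u x - \<phi> x) \<in> W \<sigma> p \<Omega> \<and> W_norm \<sigma> p \<Omega> (\<lambda>x. u x - \<phi> x) < \<epsilon>
      \<longleftrightarrow> ?P \<phi> < ennreal (\<epsilon> powr p)" if \<phi>: "\<phi> \<in> test_functions \<Omega>" and "0 < \<epsilon>" for \<phi> \<epsilon>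
  proof -
    note test_function_measurable[OF \<phi>, measurable]
    have "(\<lambda>x. u x - \<phi> x) \<in> W \<sigma> p \<Omega>" if "?P \<phi> < ennreal (\<epsilon> powr p)"
      using that less_trans[OF that ennreal_less_top] by (simp add: W_iff)
    then show ?thesis using W_norm_less_iff[OF _ p \<open>0 < \<epsilon>\<close>] by blast
  qed
  have "u \<in> W0 \<sigma> p \<Omega> \<longleftrightarrow> (\<forall>\<epsilon>>0. \<exists>\<phi>\<in>test_functions \<Omega>. ?P \<phi> < ennreal (\<epsilon> powr p))"
    using True iff by (fastforce simp: W0_def)
  also have "\<dots> \<longleftrightarrow> (\<forall>\<epsilon>>0. \<exists>\<phi>\<in>test_functions \<Omega>. ?P \<phi> < ennreal \<epsilon>)"
  proof (intro iffI allI impI)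
    fix \<epsilon> :: real assume *: "\<forall>\<epsilon>>0. \<exists>\<phi>\<in>test_functions \<Omega>. ?P \<phi> < ennreal (\<epsilon> powr p)" and "0 < \<epsilon>"
    then show "\<exists>\<phi>\<in>test_functions \<Omega>. ?P \<phi> < ennreal \<epsilon>"
      using *[rule_format, of "\<epsilon> powr (1 / p)"] p by (simp add: powr_powr)
  qed auto
  finally show ?thesis using True by blast
qed (simp add: W0_def)

section \<open>Nesting of the spaces \<open>W0\<close> and their closedness under limits\<close>

text \<open>The same test functions approximate in the lower order, since the p-th power of the norm
  grows by at most a constant factor.\<close>

lemma W0_subset:
  assumes D: "\<And>x y. x \<in> \<Omega> \<Longrightarrow> y \<in> \<Omega> \<Longrightarrow> norm (x - y) \<le> D"
    and "\<sigma> \<le> \<tau>" "0 < p"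
  shows "W0 \<tau> p \<Omega> \<subseteq> W0 \<sigma> p \<Omega>"
proof
  fix u assume u: "u \<in> W0 \<tau> p \<Omega>"
  \<comment> \<open>The maximum with 1 lets a single constant also dominate the
    \<open>Lp_mass\<close> term, which carries no factor depending on \<open>D\<close>.\<close>
  define c where "c = max 1 (D powr ((\<tau> - \<sigma>) * p))"
  have c: "c \<ge> 1" by (simp add: c_def)
  have bd: "Lp_mass p \<Omega> w + gagliardo \<sigma> p \<Omega> w \<le> ennreal c * (Lp_mass p \<Omega> w + gagliardo \<tau> p \<Omega> w)"
    if "w \<in> borel_measurable (lebesgue_on \<Omega>)" for w
  proof -
    have "gagliardo \<sigma> p \<Omega> w \<le> ennreal (D powr ((\<tau> - \<sigma>) * p)) * gagliardo \<tau> p \<Omega> w"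
      using assms that by (intro gagliardo_mono_exponent) auto
    also have "\<dots> \<le> ennreal c * gagliardo \<tau> p \<Omega> w"
      by (intro mult_right_mono ennreal_leI) (auto simp: c_def)
    finally have "gagliardo \<sigma> p \<Omega> w \<le> ennreal c * gagliardo \<tau> p \<Omega> w" .
    moreover have "1 * Lp_mass p \<Omega> w \<le> ennreal c * Lp_mass p \<Omega> w"
      using c by (intro mult_right_mono) (auto simp: ennreal_1[symmetric] simp del: ennreal_1 intro: ennreal_leI)
    ultimately show ?thesis by (simp add: distrib_left add_mono)
  qed
  have W: "u \<in> W \<tau> p \<Omega>" and [measurable]: "u \<in> borel_measurable (lebesgue_on \<Omega>)"
    using u by (auto simp: W0_def W_iff)
  have "u \<in> W \<sigma> p \<Omega>"
    using W le_less_trans[OF bd[of u], of \<infinity>] by (simp add: W_iff ennreal_mult_less_top)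
  moreover have "\<exists>\<phi>\<in>test_functions \<Omega>.
      Lp_mass p \<Omega> (\<lambda>x. u x - \<phi> x) + gagliardo \<sigma> p \<Omega> (\<lambda>x. u x - \<phi> x) < ennreal \<epsilon>"
    if "0 < \<epsilon>" for \<epsilon>
  proof -
    have "0 < \<epsilon> / c" using that c by simp
    then obtain \<phi> where \<phi>: "\<phi> \<in> test_functions \<Omega>"
      "Lp_mass p \<Omega> (\<lambda>x. u x - \<phi> x) + gagliardo \<tau> p \<Omega> (\<lambda>x. u x - \<phi> x) < ennreal (\<epsilon> / c)"
      using u W0_iff[OF \<open>0 < p\<close>] by blast
    note test_function_measurable[OF \<phi>(1), measurable]
    have "Lp_mass p \<Omega> (\<lambda>x. u x - \<phi> x) + gagliardo \<sigma> p \<Omega> (\<lambda>x. u x - \<phi> x)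
      \<le> ennreal c * (Lp_mass p \<Omega> (\<lambda>x. u x - \<phi> x) + gagliardo \<tau> p \<Omega> (\<lambda>x. u x - \<phi> x))"
      by (intro bd) simp
    also have "\<dots> < ennreal c * ennreal (\<epsilon> / c)"
      using \<phi>(2) c by (intro ennreal_mult_strict_left_mono) auto
    also have "\<dots> = ennreal \<epsilon>"
      using c that by (simp add: ennreal_mult[symmetric])
    finally show ?thesis using \<phi>(1) by blast
  qed
  ultimately show "u \<in> W0 \<sigma> p \<Omega>" by (simp add: W0_iff[OF \<open>0 < p\<close>])
qed

text \<open>A closure is closed: a test function close to a \<open>v n\<close> that is itself close
  to \<open>u\<close> is close to \<open>u\<close>. Only the quasi-triangle inequality with constant
  \<open>2 powr p\<close> is available, so the tolerances are scaled by it.\<close>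

lemma W0_closed:
  assumes p: "0 < p" and u: "u \<in> Lp p \<Omega>"
    and v: "\<And>n. v n \<in> W0 \<sigma> p \<Omega>"
    and lim: "(\<lambda>n. Lp_mass p \<Omega> (\<lambda>x. u x - v n x) + gagliardo \<sigma> p \<Omega> (\<lambda>x. u x - v n x)) \<longlonglongrightarrow> 0"
  shows "u \<in> W0 \<sigma> p \<Omega>"
proof -
  define P where "P w = Lp_mass p \<Omega> w + gagliardo \<sigma> p \<Omega> w" for w
  define c where "c = (2::real) powr p"
  have c: "c > 0" by (simp add: c_def)
  have P_add: "P (\<lambda>x. f x + g x) \<le> ennreal c * (P f + P g)"
    if "f \<in> borel_measurable (lebesgue_on \<Omega>)" "g \<in> borel_measurable (lebesgue_on \<Omega>)" for f g
    using add_mono[OF Lp_mass_add_le[OF that, of p] gagliardo_add_le[OF that, of p \<sigma>]] p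
    by (simp add: P_def c_def algebra_simps distrib_left)
  have [measurable]: "u \<in> borel_measurable (lebesgue_on \<Omega>)" "v n \<in> borel_measurable (lebesgue_on \<Omega>)" for n
    using u v by (auto simp: Lp_iff W0_def W_iff)
  have small: "\<exists>n. P (\<lambda>x. u x - v n x) < ennreal e" if "0 < e" for e
    using order_tendstoD(2)[OF lim, of "ennreal e"] that
    by (auto simp: P_def eventually_sequentially)
  \<comment> \<open>A single term at finite distance from \<open>u\<close> already gives
    \<open>u\<close> finite energy.\<close>
  obtain n where n: "P (\<lambda>x. u x - v n x) < ennreal 1" using small[of 1] by auto
  have "P u \<le> ennreal c * (P (\<lambda>x. u x - v n x) + P (v n))"
    using P_add[of "\<lambda>x. u x - v n x" "v n"] by simp
  also have "\<dots> < \<infinity>"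
    using less_trans[OF n ennreal_less_top] v[of n]
    by (auto simp: ennreal_mult_less_top W0_def W_iff P_def)
  finally have "u \<in> W \<sigma> p \<Omega>" by (simp add: W_iff P_def)
  moreover have "\<exists>\<phi>\<in>test_functions \<Omega>. P (\<lambda>x. u x - \<phi> x) < ennreal \<epsilon>" if "0 < \<epsilon>" for \<epsilon>
  proof -
    define e where "e = \<epsilon> / (2 * c)"
    have e: "0 < e" "ennreal c * (ennreal e + ennreal e) = ennreal \<epsilon>"
      using that c by (auto simp: e_def ennreal_mult[symmetric] ennreal_plus[symmetric] simp del: ennreal_plus)
    obtain n where n: "P (\<lambda>x. u x - v n x) < ennreal e" using small e by blast
    obtain \<phi> where \<phi>: "\<phi> \<in> test_functions \<Omega>" "P (\<lambda>x. v n x - \<phi> x) < ennreal e"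
      using v[of n] e unfolding W0_iff[OF p] P_def by blast
    note test_function_measurable[OF \<phi>(1), measurable]
    have "P (\<lambda>x. u x - \<phi> x) \<le> ennreal c * (P (\<lambda>x. u x - v n x) + P (\<lambda>x. v n x - \<phi> x))"
      using P_add[of "\<lambda>x. u x - v n x" "\<lambda>x. v n x - \<phi> x"] by simp
    also have "\<dots> < ennreal c * (ennreal e + ennreal e)"
      using n \<phi>(2) c by (intro ennreal_mult_strict_left_mono add_strict_mono) auto
    finally show ?thesis using e \<phi>(1) by auto
  qed
  ultimately show ?thesis by (simp add: W0_iff[OF p] P_def)
qed

text \<open>Two-stage choice in \<open>gagliardo_interpolation\<close>, applied to the differences:
  first \<open>\<delta>\<close>, making the near part small uniformly in \<open>n\<close>, then
  \<open>n\<close>, making the far part small.\<close>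

lemma W0_limit:
  assumes \<Omega>: "\<Omega> \<in> lmeasurable" and p: "0 < p" and "0 \<le> \<sigma>" "\<sigma> < \<tau>"
    and u: "u \<in> Lp p \<Omega>" and v: "\<And>n. v n \<in> W0 \<sigma> p \<Omega>"
    and bd: "\<And>n. gagliardo \<tau> p \<Omega> (v n) \<le> ennreal C" and bdu: "gagliardo \<tau> p \<Omega> u < \<infinity>"
    and lim: "(\<lambda>n. Lp_mass p \<Omega> (\<lambda>x. u x - v n x)) \<longlonglongrightarrow> 0"
  shows "u \<in> W0 \<sigma> p (\<Omega> :: 'a::euclidean_space set)"
proof (rule W0_closed[OF p u v])
  have [measurable]: "u \<in> borel_measurable (lebesgue_on \<Omega>)" "v n \<in> borel_measurable (lebesgue_on \<Omega>)" for n
    using u v by (auto simp: Lp_iff W0_def W_iff)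
  define K where "K = enn2real (ennreal (2 powr p) * (gagliardo \<tau> p \<Omega> u + ennreal C))"
  have K: "gagliardo \<tau> p \<Omega> (\<lambda>x. u x - v n x) \<le> ennreal K" "0 \<le> K" for n
  proof -
    have "gagliardo \<tau> p \<Omega> (\<lambda>x. u x - v n x) \<le> ennreal (2 powr p) * (gagliardo \<tau> p \<Omega> u + gagliardo \<tau> p \<Omega> (v n))"
      using p by (intro gagliardo_diff_le) auto
    also have "\<dots> \<le> ennreal (2 powr p) * (gagliardo \<tau> p \<Omega> u + ennreal C)"
      using bd by (intro mult_left_mono add_mono) auto
    also have "\<dots> = ennreal K"
      using bdu by (simp add: K_def ennreal_mult_less_top)
    finally show "gagliardo \<tau> p \<Omega> (\<lambda>x. u x - v n x) \<le> ennreal K" .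
  qed (simp add: K_def)
  have "(\<lambda>n. gagliardo \<sigma> p \<Omega> (\<lambda>x. u x - v n x)) \<longlonglongrightarrow> 0"
  proof (rule order_tendstoI)
    fix e :: ennreal assume "0 < e"
    \<comment> \<open>Half of \<open>e\<close> when \<open>e\<close> is finite; for infinite
      \<open>e\<close> any positive real serves.\<close>
    obtain r where r: "0 < r" "ennreal r + ennreal r \<le> e"
    proof (cases e)
      case (real a)
      then show ?thesis
        using that[of "a / 2"] \<open>0 < e\<close> by (simp add: ennreal_plus[symmetric] del: ennreal_plus)
    qed (use that[of 1] in simp)
    \<comment> \<open>Chosen so that the near part is at most \<open>r / (K + 1) * K\<close>, hence
      at most \<open>r\<close>; the added 1 keeps the quotient meaningful when \<open>K\<close> is
      0.\<close>
    define \<delta> where "\<delta> = (r / (K + 1)) powr (1 / ((\<tau> - \<sigma>) * p))"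
    have \<delta>: "0 < \<delta>" "\<delta> powr ((\<tau> - \<sigma>) * p) = r / (K + 1)"
      using r(1) K(2) assms by (auto simp: \<delta>_def powr_powr)
    define A where "A = ennreal (2 powr p / \<delta> powr (real DIM('a) + \<sigma> * p)) * (2 * emeasure lebesgue \<Omega>)"
    have A: "A < \<infinity>"
      using \<Omega> by (auto simp: A_def ennreal_mult_less_top fmeasurable_def less_top)
    have "(\<lambda>n. A * Lp_mass p \<Omega> (\<lambda>x. u x - v n x)) \<longlonglongrightarrow> A * 0"
      using lim A by (intro ennreal_tendsto_cmult) auto
    then have "(\<lambda>n. A * Lp_mass p \<Omega> (\<lambda>x. u x - v n x)) \<longlonglongrightarrow> 0" by simp
    then have "\<forall>\<^sub>F n in sequentially. A * Lp_mass p \<Omega> (\<lambda>x. u x - v n x) < ennreal r"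
      by (rule order_tendstoD(2)) (simp add: r)
    then show "\<forall>\<^sub>F n in sequentially. gagliardo \<sigma> p \<Omega> (\<lambda>x. u x - v n x) < e"
    proof eventually_elim
      case (elim n)
      have "gagliardo \<sigma> p \<Omega> (\<lambda>x. u x - v n x)
        \<le> ennreal (\<delta> powr ((\<tau> - \<sigma>) * p)) * gagliardo \<tau> p \<Omega> (\<lambda>x. u x - v n x)
          + A * Lp_mass p \<Omega> (\<lambda>x. u x - v n x)"
        unfolding A_def mult.assoc[of "ennreal _"]
        using assms \<delta>(1) by (intro gagliardo_interpolation) auto
      also have "ennreal (\<delta> powr ((\<tau> - \<sigma>) * p)) * gagliardo \<tau> p \<Omega> (\<lambda>x. u x - v n x)
        \<le> ennreal (r / (K + 1)) * ennreal K"
        unfolding \<delta> by (intro mult_left_mono K) auto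
      also have "\<dots> \<le> ennreal r"
        using r(1) K(2)
        by (auto simp: ennreal_mult[symmetric] field_simps intro!: ennreal_leI)
      finally have "gagliardo \<sigma> p \<Omega> (\<lambda>x. u x - v n x) \<le> ennreal r + A * Lp_mass p \<Omega> (\<lambda>x. u x - v n x)"
        by (simp add: add_right_mono)
      also have "\<dots> < ennreal r + ennreal r"
        using elim by (simp add: ennreal_add_left_cancel_less)
      also note r(2)
      finally show ?case .
    qed
  qed simp
  from tendsto_add[OF lim this]
  show "(\<lambda>n. Lp_mass p \<Omega> (\<lambda>x. u x - v n x) + gagliardo \<sigma> p \<Omega> (\<lambda>x. u x - v n x)) \<longlonglongrightarrow> 0"
    by simp
qed

section \<open>From convergence in mean to Fatou's lemma with varying orders\<close>

text \<open>\<open>Lp_dist\<close> passes through \<open>enn2real\<close>, so the masses of the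
  differences must first be shown finite before convergence can be carried back to
  \<open>ennreal\<close>.\<close>

lemma Lp_dist_tendsto_0D:
  assumes p: "0 < p" and u: "u \<in> Lp p \<Omega>" and v: "\<And>n. v n \<in> Lp p \<Omega>"
    and lim: "(\<lambda>n. Lp_dist p \<Omega> (v n) u) \<longlonglongrightarrow> 0"
  shows "(\<lambda>n. Lp_mass p \<Omega> (\<lambda>x. u x - v n x)) \<longlonglongrightarrow> 0"
proof -
  define r where "r = (\<lambda>n. enn2real (Lp_mass p \<Omega> (\<lambda>x. u x - v n x)))"
  have fin: "Lp_mass p \<Omega> (\<lambda>x. u x - v n x) < \<infinity>" for n
  proof (rule le_less_trans)
    show "Lp_mass p \<Omega> (\<lambda>x. u x - v n x) \<le> ennreal (2 powr p) * (Lp_mass p \<Omega> u + Lp_mass p \<Omega> (v n))"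
      using u v p by (intro Lp_mass_diff_le) (auto simp: Lp_iff)
    show "\<dots> < \<infinity>" using u v by (auto simp: Lp_iff ennreal_mult_less_top)
  qed
  have "Lp_dist p \<Omega> (v n) u = r n powr (1 / p)" for n
    by (simp add: Lp_dist_def r_def Lp_mass_def abs_minus_commute)
  then have "(\<lambda>n. r n powr (1 / p)) \<longlonglongrightarrow> 0" using lim by simp
  then have "(\<lambda>n. (r n powr (1 / p)) powr p) \<longlonglongrightarrow> 0 powr p"
    using p by (intro tendsto_powr2) auto
  then have "r \<longlonglongrightarrow> 0" using p by (simp add: powr_powr r_def)
  then have "(\<lambda>n. ennreal (r n)) \<longlonglongrightarrow> 0"
    using tendsto_ennrealI by fastforce
  then show ?thesis using fin by (simp add: r_def)
qed

text \<open>The p-th powers tend to 0 in the sense of integrable functions, so a subsequence of them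
  tends to 0 almost everywhere; p-th roots finish the argument.\<close>

lemma Lp_mass_tendsto_0_AE_subseq:
  assumes p: "0 < p"
    and [measurable]: "\<And>n. w n \<in> borel_measurable (lebesgue_on \<Omega>)"
    and lim: "(\<lambda>n. Lp_mass p \<Omega> (w n)) \<longlonglongrightarrow> 0"
  shows "\<exists>r::nat \<Rightarrow> nat. strict_mono r \<and> (AE x in lebesgue_on \<Omega>. (\<lambda>n. w (r n) x) \<longlonglongrightarrow> 0)"
proof -
  have "\<forall>\<^sub>F n in sequentially. Lp_mass p \<Omega> (w n) < 1"
    using order_tendstoD(2)[OF lim] by simp
  then obtain N where N: "\<And>n. n \<ge> N \<Longrightarrow> Lp_mass p \<Omega> (w n) < 1"
    by (auto simp: eventually_sequentially)
  \<comment> \<open>The shift by \<open>N\<close> drops the terms whose mass may be infinite, since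
    \<open>tendsto_L1_AE_subseq\<close> asks for integrability of every term.\<close>
  define f where "f = (\<lambda>n x. \<bar>w (n + N) x\<bar> powr p)"
  have int: "integrable (lebesgue_on \<Omega>) (f n)" for n
    unfolding f_def using less_trans[OF N[of "n + N"] ennreal_one_less_top]
    by (intro integrableI_nonneg) (auto simp: Lp_mass_def)
  have eq: "ennreal (\<integral>x. norm (f n x) \<partial>lebesgue_on \<Omega>) = Lp_mass p \<Omega> (w (n + N))" for n
    using nn_integral_eq_integral[OF int[of n]] by (simp add: f_def Lp_mass_def)
  have "(\<lambda>n. ennreal (\<integral>x. norm (f n x) \<partial>lebesgue_on \<Omega>)) \<longlonglongrightarrow> ennreal 0"
    unfolding eq using LIMSEQ_ignore_initial_segment[OF lim, of N] by simp
  then have "(\<lambda>n. (\<integral>x. norm (f n x) \<partial>lebesgue_on \<Omega>)) \<longlonglongrightarrow> 0"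
    by (subst (asm) tendsto_ennreal_iff) auto
  then obtain r where r: "strict_mono r" "AE x in lebesgue_on \<Omega>. (\<lambda>n. f (r n) x) \<longlonglongrightarrow> 0"
    using tendsto_L1_AE_subseq[of "lebesgue_on \<Omega>" f, OF int] by blast
  have "(\<lambda>n. w (r n + N) x) \<longlonglongrightarrow> 0" if "(\<lambda>n. f (r n) x) \<longlonglongrightarrow> 0" for x
  proof -
    have "(\<lambda>n. f (r n) x powr (1 / p)) \<longlonglongrightarrow> 0 powr (1 / p)"
      using p that by (intro tendsto_powr2) (auto simp: f_def)
    then have "(\<lambda>n. \<bar>w (r n + N) x\<bar>) \<longlonglongrightarrow> 0"
      using p by (simp add: f_def powr_powr)
    then show ?thesis by (rule tendsto_rabs_zero_cancel)
  qed
  then have "AE x in lebesgue_on \<Omega>. (\<lambda>n. w (r n + N) x) \<longlonglongrightarrow> 0"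
    using AE_mp[OF r(2)] by (simp add: AE_I2)
  moreover have "strict_mono (\<lambda>n. r n + N)" using r(1) by (simp add: strict_mono_def)
  ultimately show ?thesis by blast
qed

text \<open>Function and order vary together. Off the diagonal the kernel is continuous in the
  order, so the integrands converge almost everywhere along a subsequence; the bound
  \<open>C\<close> holds for all indices and thus survives the extraction.\<close>

lemma gagliardo_Fatou:
  assumes \<Omega>: "\<Omega> \<in> lmeasurable" and p: "0 < p"
    and u[measurable]: "u \<in> borel_measurable (lebesgue_on \<Omega>)"
    and v[measurable]: "\<And>n. v n \<in> borel_measurable (lebesgue_on \<Omega>)"
    and lim: "(\<lambda>n. Lp_mass p \<Omega> (\<lambda>x. u x - v n x)) \<longlonglongrightarrow> 0"
    and \<sigma>: "\<sigma> \<longlonglongrightarrow> s" and bd: "\<And>n. gagliardo (\<sigma> n) p \<Omega> (v n) \<le> C"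
  shows "gagliardo s p \<Omega> (u :: 'a::euclidean_space \<Rightarrow> real) \<le> C"
proof -
  note gagliardo_integrand_measurable[measurable]
  interpret pair_sigma_finite "lebesgue_on \<Omega>" "lebesgue_on \<Omega>"
    by (rule pair_sigma_finite_lebesgue_on[OF \<Omega>])
  let ?P = "lebesgue_on \<Omega> \<Otimes>\<^sub>M lebesgue_on \<Omega>"
  obtain r :: "nat \<Rightarrow> nat" where r: "strict_mono r" "AE x in lebesgue_on \<Omega>. (\<lambda>n. u x - v (r n) x) \<longlonglongrightarrow> 0"
    using Lp_mass_tendsto_0_AE_subseq[OF p _ lim] by auto
  have AE1: "AE x in lebesgue_on \<Omega>. (\<lambda>n. v (r n) x) \<longlonglongrightarrow> u x"
    using r(2)
  proof eventually_elim
    case (elim x)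
    from tendsto_diff[OF tendsto_const[of "u x"] elim] show ?case by simp
  qed
  \<comment> \<open>Convergence is needed at both coordinates at once; almost every \<open>x\<close>
    paired with almost every \<open>y\<close> covers almost every pair.\<close>
  have "AE z in ?P. (\<lambda>n. v (r n) (fst z)) \<longlonglongrightarrow> u (fst z) \<and> (\<lambda>n. v (r n) (snd z)) \<longlonglongrightarrow> u (snd z)"
  proof (rule AE_pair_measure)
    show "{z \<in> space ?P. (\<lambda>n. v (r n) (fst z)) \<longlonglongrightarrow> u (fst z) \<and> (\<lambda>n. v (r n) (snd z)) \<longlonglongrightarrow> u (snd z)} \<in> sets ?P"
      by measurable
    show "AE x in lebesgue_on \<Omega>. AE y in lebesgue_on \<Omega>.
      (\<lambda>n. v (r n) (fst (x, y))) \<longlonglongrightarrow> u (fst (x, y)) \<and> (\<lambda>n. v (r n) (snd (x, y))) \<longlonglongrightarrow> u (snd (x, y))"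
      using AE1 by eventually_elim (use AE1 in simp)
  qed
  then have "AE z in ?P. ennreal (gagliardo_integrand s p u z)
      \<le> liminf (\<lambda>n. ennreal (gagliardo_integrand (\<sigma> (r n)) p (v (r n)) z))"
  proof eventually_elim
    case (elim z)
    obtain x y where z: "z = (x, y)" by fastforce
    have "(\<lambda>n. gagliardo_integrand (\<sigma> (r n)) p (v (r n)) z) \<longlonglongrightarrow> gagliardo_integrand s p u z"
    \<comment> \<open>On the diagonal all integrands vanish; off it the limit of the denominators is
      nonzero and the quotients converge.\<close>
    proof (cases "x = y")
      case True
      then show ?thesis by (simp add: z gagliardo_integrand_def)
    next
      case False
      have "(\<lambda>n. \<sigma> (r n)) \<longlonglongrightarrow> s" using LIMSEQ_subseq_LIMSEQ[OF \<sigma> r(1)] by (simp add: o_def)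
      then have "(\<lambda>n. norm (x - y) powr (real DIM('a) + \<sigma> (r n) * p))
          \<longlonglongrightarrow> norm (x - y) powr (real DIM('a) + s * p)"
        using False by (intro tendsto_intros) auto
      moreover have "(\<lambda>n. \<bar>v (r n) x - v (r n) y\<bar> powr p) \<longlonglongrightarrow> \<bar>u x - u y\<bar> powr p"
        using elim p by (intro tendsto_powr2 tendsto_intros) (auto simp: z)
      ultimately show ?thesis
        unfolding z gagliardo_integrand_def prod.case using False
        by (intro tendsto_divide) auto
    qed
    then have "(\<lambda>n. ennreal (gagliardo_integrand (\<sigma> (r n)) p (v (r n)) z)) \<longlonglongrightarrow> ennreal (gagliardo_integrand s p u z)"
      by (rule tendsto_ennrealI)
    then show ?case by (simp add: lim_imp_Liminf)
  qed
  then have "gagliardo s p \<Omega> u \<le> (\<integral>\<^sup>+ z. liminf (\<lambda>n. ennreal (gagliardo_integrand (\<sigma> (r n)) p (v (r n)) z)) \<partial>?P)"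
    unfolding gagliardo_eq by (rule nn_integral_mono_AE)
  also have "\<dots> \<le> liminf (\<lambda>n. gagliardo (\<sigma> (r n)) p \<Omega> (v (r n)))"
    unfolding gagliardo_eq by (rule nn_integral_liminf) measurable
  also have "\<dots> \<le> liminf (\<lambda>n. C)" by (intro Liminf_mono always_eventually allI bd)
  also have "\<dots> = C" by (simp add: Liminf_const)
  finally show ?thesis .
qed

section \<open>The two inequalities of Gamma-convergence\<close>

text \<open>If the inequality failed, some level \<open>c\<close> would lie strictly between the two
  sides. Infinitely many energies are then below \<open>c\<close>, and the subsequence they form
  places \<open>u\<close> in \<open>W0_minus\<close> with energy at most \<open>c\<close>.\<close>

lemma Gamma_liminf_energy:
  assumes \<Omega>: "\<Omega> \<in> lmeasurable" and p: "0 < p"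
    and D: "\<And>x y. x \<in> \<Omega> \<Longrightarrow> y \<in> \<Omega> \<Longrightarrow> norm (x - y) \<le> D"
    and sj: "\<And>j. sj j < s" "sj \<longlonglongrightarrow> s"
    and eq: "W0_minus s p \<Omega> = W0 s p \<Omega>"
    and u: "u \<in> Lp p \<Omega>" and v: "\<And>n. v n \<in> Lp p \<Omega>"
    and lim: "(\<lambda>n. Lp_dist p \<Omega> (v n) u) \<longlonglongrightarrow> 0"
  shows "energy s p \<Omega> u \<le> liminf (\<lambda>n. energy (sj n) p \<Omega> (v n))"
proof (rule ccontr)
  assume "\<not> ?thesis"
  then obtain c where c: "liminf (\<lambda>n. energy (sj n) p \<Omega> (v n)) < c" "c < energy s p \<Omega> u"
    using dense[of "liminf (\<lambda>n. energy (sj n) p \<Omega> (v n))" "energy s p \<Omega> u"] by (auto simp: not_le)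
  have "\<exists>\<^sub>F n in sequentially. energy (sj n) p \<Omega> (v n) < c"
  proof (rule ccontr)
    assume "\<not> ?thesis"
    then have "c \<le> liminf (\<lambda>n. energy (sj n) p \<Omega> (v n))"
      by (intro Liminf_bounded) (simp add: not_frequently not_less)
    with c(1) show False by simp
  qed
  then have "infinite {n. energy (sj n) p \<Omega> (v n) < c}"
    by (simp add: cofinite_eq_sequentially[symmetric] frequently_cofinite)
  from infinite_enumerate[OF this] obtain r :: "nat \<Rightarrow> nat" where r: "strict_mono r"
    "\<And>n. energy (sj (r n)) p \<Omega> (v (r n)) < c" unfolding mem_Collect_eq by blast
  \<comment> \<open>A level strictly below another value cannot be infinite.\<close>
  obtain C where C: "c = ennreal C" "0 \<le> C"
    using c(2) by (cases c) auto
  have vr: "v (r n) \<in> W0 (sj (r n)) p \<Omega>" "gagliardo (sj (r n)) p \<Omega> (v (r n)) < c" for n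
    using r(2)[of n] by (auto simp: energy_def split: if_splits)
  have [measurable]: "u \<in> borel_measurable (lebesgue_on \<Omega>)" "v n \<in> borel_measurable (lebesgue_on \<Omega>)" for n
    using u v by (auto simp: Lp_iff)
  have mass: "(\<lambda>n. Lp_mass p \<Omega> (\<lambda>x. u x - v (r n) x)) \<longlonglongrightarrow> 0"
    using LIMSEQ_subseq_LIMSEQ[OF Lp_dist_tendsto_0D[OF p u v lim] r(1)] by (simp add: o_def)
  have sr: "(\<lambda>n. sj (r n)) \<longlonglongrightarrow> s"
    using LIMSEQ_subseq_LIMSEQ[OF sj(2) r(1)] by (simp add: o_def)
  have gs: "gagliardo s p \<Omega> u \<le> c"
    by (intro gagliardo_Fatou[OF \<Omega> p _ _ mass sr] less_imp_le[OF vr(2)]) simp_all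
  also have "c < \<infinity>" by (simp add: C)
  finally have gs_fin: "gagliardo s p \<Omega> u < \<infinity>" .
  have "u \<in> W0 k p \<Omega>" if k: "0 < k" "k < s" for k
  proof -
    \<comment> \<open>An intermediate order: the tail of the subsequence has orders above
      \<open>\<tau>\<close> and is bounded there, and the gap between \<open>k\<close> and
      \<open>\<tau>\<close> is what \<open>W0_limit\<close> exploits.\<close>
    define \<tau> where "\<tau> = (k + s) / 2"
    have \<tau>: "k < \<tau>" "\<tau> < s" using k by (auto simp: \<tau>_def)
    obtain N where N: "\<And>n. n \<ge> N \<Longrightarrow> \<tau> < sj (r n)"
      using order_tendstoD(1)[OF sr \<tau>(2)] by (auto simp: eventually_sequentially)
    \<comment> \<open>A base of at least 1 makes the power increasing in the exponent, so the
      varying order can be replaced by \<open>s\<close> and the bound becomes uniform.\<close>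
    define B where "B = max 1 D powr ((s - \<tau>) * p) * C"
    have D': "norm (x - y) \<le> max 1 D" if "x \<in> \<Omega>" "y \<in> \<Omega>" for x y
      using D[OF that] by simp
    show ?thesis
    proof (rule W0_limit[OF \<Omega> p _ \<tau>(1) u, where C = B and v = "\<lambda>n. v (r (n + N))"])
      show "v (r (n + N)) \<in> W0 k p \<Omega>" for n
        using W0_subset[OF D _ p, of \<Omega> k "sj (r (n + N))"] vr(1)[of "n + N"] N[of "n + N"] \<tau> by auto
      show "gagliardo \<tau> p \<Omega> (v (r (n + N))) \<le> ennreal B" for n
      proof -
        let ?m = "n + N"
        have "gagliardo \<tau> p \<Omega> (v (r ?m))
          \<le> ennreal (max 1 D powr ((sj (r ?m) - \<tau>) * p)) * gagliardo (sj (r ?m)) p \<Omega> (v (r ?m))"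
          using N[of ?m] p by (intro gagliardo_mono_exponent D') auto
        also have "\<dots> \<le> ennreal (max 1 D powr ((s - \<tau>) * p)) * ennreal C"
          using vr(2)[of ?m] sj(1)[of "r ?m"] p
          by (intro mult_mono ennreal_leI powr_mono mult_right_mono) (simp_all add: C less_imp_le)
        also have "\<dots> = ennreal B" by (simp add: B_def ennreal_mult C)
        finally show ?thesis .
      qed
      have "gagliardo \<tau> p \<Omega> u \<le> ennreal (D powr ((s - \<tau>) * p)) * gagliardo s p \<Omega> u"
        using \<tau> p by (intro gagliardo_mono_exponent D) auto
      also have "\<dots> < \<infinity>" using gs_fin by (simp add: ennreal_mult_less_top)
      finally show "gagliardo \<tau> p \<Omega> u < \<infinity>" .
      show "(\<lambda>n. Lp_mass p \<Omega> (\<lambda>x. u x - v (r (n + N)) x)) \<longlonglongrightarrow> 0"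
        using LIMSEQ_ignore_initial_segment[OF mass, of N] by simp
    qed (use k in simp)
  qed
  \<comment> \<open>The assumed equality of spaces turns membership in all lower orders into
    membership at order \<open>s\<close> itself, where the energy equals the Gagliardo
    integral.\<close>
  then have "u \<in> W0_minus s p \<Omega>"
    using u gs_fin by (auto simp: W0_minus_def W_def)
  then have "energy s p \<Omega> u \<le> c" using gs eq by (simp add: energy_def)
  with c(2) show False by simp
qed

text \<open>Along the constant sequence the comparison factor has exponent
  \<open>(s - sj n) * p\<close>, which tends to 0, so the factor tends to 1.\<close>

lemma limsup_energy_le:
  assumes p: "0 < p" and D: "\<And>x y. x \<in> \<Omega> \<Longrightarrow> y \<in> \<Omega> \<Longrightarrow> norm (x - y) \<le> D"
    and sj: "\<And>j. sj j < s" "sj \<longlonglongrightarrow> s" and u: "u \<in> W0 s p \<Omega>"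
  shows "limsup (\<lambda>n. energy (sj n) p \<Omega> u) \<le> gagliardo s p \<Omega> u"
proof -
  have D': "norm (x - y) \<le> max 1 D" if "x \<in> \<Omega>" "y \<in> \<Omega>" for x y
    using D[OF that] by simp
  have "energy (sj n) p \<Omega> u
      \<le> ennreal (max 1 D powr ((s - sj n) * p)) * gagliardo s p \<Omega> u" for n
  proof -
    have "energy (sj n) p \<Omega> u = gagliardo (sj n) p \<Omega> u"
      using W0_subset[OF D _ p, of \<Omega> "sj n" s] sj(1)[of n] u by (auto simp: energy_def)
    also have "\<dots> \<le> ennreal (max 1 D powr ((s - sj n) * p)) * gagliardo s p \<Omega> u"
      using u sj(1)[of n] p by (intro gagliardo_mono_exponent D') (auto simp: W0_def W_iff)
    finally show ?thesis .
  qed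
  then have "limsup (\<lambda>n. energy (sj n) p \<Omega> u)
    \<le> limsup (\<lambda>n. ennreal (max 1 D powr ((s - sj n) * p)) * gagliardo s p \<Omega> u)"
    by (intro Limsup_mono always_eventually allI)
  also have "\<dots> = gagliardo s p \<Omega> u"
  proof (rule lim_imp_Limsup)
    have "(\<lambda>n. max 1 D powr ((s - sj n) * p)) \<longlonglongrightarrow> max 1 D powr ((s - s) * p)"
      by (intro tendsto_intros sj) auto
    then have "(\<lambda>n. ennreal (max 1 D powr ((s - sj n) * p))) \<longlonglongrightarrow> 1"
      by (auto dest!: tendsto_ennrealI simp: max_def split: if_splits)
    then have "(\<lambda>n. gagliardo s p \<Omega> u * ennreal (max 1 D powr ((s - sj n) * p))) \<longlonglongrightarrow> gagliardo s p \<Omega> u * 1"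
      using u by (intro ennreal_tendsto_cmult) (auto simp: W0_def W_def)
    then show "(\<lambda>n. ennreal (max 1 D powr ((s - sj n) * p)) * gagliardo s p \<Omega> u) \<longlonglongrightarrow> gagliardo s p \<Omega> u"
      by (simp add: mult.commute)
  qed simp
  finally show ?thesis .
qed

lemma Lp_dist_self: "Lp_dist p \<Omega> u u = 0"
  by (simp add: Lp_dist_def)

section \<open>Equivalence of Gamma-convergence and equality of the spaces\<close>

theorem corollary3p1:
  fixes s p :: real and \<Omega> :: "'a::euclidean_space set"
  assumes "s \<in> {0<..<1}" and "1 < p" and "open \<Omega>" and "bounded \<Omega>"
  shows "(\<forall>sj :: nat \<Rightarrow> real.
            (\<forall>j. sj j \<in> {0<..<1}) \<and> strict_mono sj \<and> sj \<longlonglongrightarrow> s \<longrightarrow>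
            Gamma_converges (Lp p \<Omega>) (Lp_dist p \<Omega>) (\<lambda>j. energy (sj j) p \<Omega>) (energy s p \<Omega>))
         \<longleftrightarrow> W0_minus s p \<Omega> = W0 s p \<Omega>"
proof -
  have p: "0 < p" and \<Omega>: "\<Omega> \<in> lmeasurable"
    using assms by (auto intro: lmeasurable_open)
  define D where "D = diameter \<Omega>"
  have D: "norm (x - y) \<le> D" if "x \<in> \<Omega>" "y \<in> \<Omega>" for x y
    using diameter_bounded_bound[OF \<open>bounded \<Omega>\<close> that] by (simp add: D_def dist_norm)
  have sub: "W0 s p \<Omega> \<subseteq> W0_minus s p \<Omega>"
  proof
    fix u assume u: "u \<in> W0 s p \<Omega>"
    have "u \<in> W0 k p \<Omega>" if "k < s" for k
      using W0_subset[OF D _ p, of \<Omega> k s] that u by auto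
    with u show "u \<in> W0_minus s p \<Omega>" by (simp add: W0_minus_def W0_def)
  qed
  show ?thesis
  proof (intro iffI allI impI)
    fix sj :: "nat \<Rightarrow> real"
    assume eq: "W0_minus s p \<Omega> = W0 s p \<Omega>"
      and "(\<forall>j. sj j \<in> {0<..<1}) \<and> strict_mono sj \<and> sj \<longlonglongrightarrow> s"
    then have mono: "strict_mono sj" and lim: "sj \<longlonglongrightarrow> s" by auto
    \<comment> \<open>Strictness comes from comparing \<open>sj j\<close> with the next term, which
      is still at most the limit.\<close>
    have lt: "sj j < s" for j
      using incseq_le[OF strict_mono_mono[OF mono] lim, of "Suc j"] strict_monoD[OF mono, of j "Suc j"]
      by simp
    show "Gamma_converges (Lp p \<Omega>) (Lp_dist p \<Omega>) (\<lambda>j. energy (sj j) p \<Omega>) (energy s p \<Omega>)"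
      unfolding Gamma_converges_def
    proof (intro conjI ballI allI impI)
      fix u v assume "u \<in> Lp p \<Omega>" "(\<forall>n. v n \<in> Lp p \<Omega>) \<and> (\<lambda>n. Lp_dist p \<Omega> (v n) u) \<longlonglongrightarrow> 0"
      then show "energy s p \<Omega> u \<le> liminf (\<lambda>n. energy (sj n) p \<Omega> (v n))"
        using Gamma_liminf_energy[OF \<Omega> p D lt lim eq] by blast
    next
      fix u assume "u \<in> Lp p \<Omega>"
      \<comment> \<open>For \<open>u\<close> outside \<open>W0 s p \<Omega>\<close> the right-hand
        side is infinite, so the constant sequence is a recovery sequence for every
        \<open>u\<close>.\<close>
      moreover have "limsup (\<lambda>n. energy (sj n) p \<Omega> u) \<le> energy s p \<Omega> u"
        using limsup_energy_le[OF p D lt lim] by (simp add: energy_def)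
      ultimately show "\<exists>v. (\<forall>n. v n \<in> Lp p \<Omega>) \<and> (\<lambda>n. Lp_dist p \<Omega> (v n) u) \<longlonglongrightarrow> 0 \<and>
          limsup (\<lambda>n. energy (sj n) p \<Omega> (v n)) \<le> energy s p \<Omega> u"
        by (intro exI[of _ "\<lambda>_. u"]) (simp add: Lp_dist_self)
    qed
  next
    assume Gamma: "\<forall>sj :: nat \<Rightarrow> real. (\<forall>j. sj j \<in> {0<..<1}) \<and> strict_mono sj \<and> sj \<longlonglongrightarrow> s \<longrightarrow>
      Gamma_converges (Lp p \<Omega>) (Lp_dist p \<Omega>) (\<lambda>j. energy (sj j) p \<Omega>) (energy s p \<Omega>)"
    have "W0_minus s p \<Omega> \<subseteq> W0 s p \<Omega>"
    proof
      fix u assume u: "u \<in> W0_minus s p \<Omega>"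
      then have W: "u \<in> Lp p \<Omega>" "gagliardo s p \<Omega> u < \<infinity>" "u \<in> borel_measurable (lebesgue_on \<Omega>)"
        by (auto simp: W0_minus_def W_def Lp_iff)
      \<comment> \<open>The offset 2 keeps the first term positive: it equals \<open>s / 2\<close>,
        whereas an offset of 1 would start at 0.\<close>
      define sj where "sj j = s - s / real (j + 2)" for j
      have s: "0 < s" "s < 1" using assms by auto
      have sj: "0 < sj j" "sj j < s" for j
        using s by (auto simp: sj_def field_simps intro!: add_pos_nonneg)
      have "strict_mono sj"
        using s by (auto simp: sj_def strict_mono_Suc_iff intro!: divide_strict_left_mono)
      moreover have "sj \<longlonglongrightarrow> s"
      proof -
        have "(\<lambda>j. s / real (j + 2)) \<longlonglongrightarrow> 0"
          using LIMSEQ_ignore_initial_segment[OF lim_const_over_n[of s], of 2] by simp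
        from tendsto_diff[OF tendsto_const this] show ?thesis by (simp add: sj_def[abs_def])
      qed
      moreover have "sj j \<in> {0<..<1}" for j using sj[of j] s by auto
      ultimately have "Gamma_converges (Lp p \<Omega>) (Lp_dist p \<Omega>) (\<lambda>j. energy (sj j) p \<Omega>) (energy s p \<Omega>)"
        using Gamma by blast
      then have "\<And>u v. u \<in> Lp p \<Omega> \<Longrightarrow> (\<forall>n. v n \<in> Lp p \<Omega>) \<Longrightarrow> (\<lambda>n. Lp_dist p \<Omega> (v n) u) \<longlonglongrightarrow> 0 \<Longrightarrow>
          energy s p \<Omega> u \<le> liminf (\<lambda>n. energy (sj n) p \<Omega> (v n))"
        unfolding Gamma_converges_def by blast
      from this[of u "\<lambda>_. u"] have "energy s p \<Omega> u \<le> liminf (\<lambda>n. energy (sj n) p \<Omega> u)"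
        using W by (simp add: Lp_dist_self)
      \<comment> \<open>As \<open>sj n\<close> is positive and the base at least 1, the exponent can
        be enlarged to \<open>s * p\<close>, which gives a finite bound independent of
        \<open>n\<close>.\<close>
      also have "\<dots> \<le> liminf (\<lambda>n. ennreal (max 1 D powr (s * p)) * gagliardo s p \<Omega> u)"
      proof (intro Liminf_mono always_eventually allI)
        fix n
        have "u \<in> W0 (sj n) p \<Omega>" using u sj[of n] by (simp add: W0_minus_def)
        then have "energy (sj n) p \<Omega> u = gagliardo (sj n) p \<Omega> u" by (simp add: energy_def)
        also have "\<dots> \<le> ennreal (max 1 D powr ((s - sj n) * p)) * gagliardo s p \<Omega> u"
          using sj[of n] p W D by (intro gagliardo_mono_exponent) (auto simp: le_max_iff_disj)
        also have "\<dots> \<le> ennreal (max 1 D powr (s * p)) * gagliardo s p \<Omega> u"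
          using sj[of n] p by (intro mult_right_mono ennreal_leI powr_mono) auto
        finally show "energy (sj n) p \<Omega> u \<le> ennreal (max 1 D powr (s * p)) * gagliardo s p \<Omega> u" .
      qed
      also have "\<dots> < \<infinity>" using W by (simp add: Liminf_const ennreal_mult_less_top)
      \<comment> \<open>The energy is infinite outside \<open>W0\<close>, so its finiteness is
        exactly the desired membership.\<close>
      finally show "u \<in> W0 s p \<Omega>" by (simp add: energy_def split: if_splits)
    qed
    with sub show "W0_minus s p \<Omega> = W0 s p \<Omega>" by blast
  qed
qed

end
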